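(* Let $(X,p,E)$ be a lattice-normed space, where $(E,\|\cdot\|_E)$ is a normed lattice, and let $(Y,m,F)$ be a lattice-normed space, where $(F,\|\cdot\|_F)$ is a Banach lattice. Let $T:X\to Y$ be linear. If $T:(X,p\text{-}\|\cdot\|_E)\to(Y,m\text{-}\|\cdot\|_F)$ is compact, then $T:(X,p,E)\to(Y,m,F)$ is sequentially $p$-compact.
   Context: All vector lattices are real and Archimedean. A net $(x_\alpha)$ in a vector lattice $X$ order converges to $x$ (written $x_\alpha\xrightarrow{o}x$) if there is a net $(y_\beta)_{\beta\in B}$ (possibly with a different index set) with $y_\beta\downarrow 0$ such that for every $\beta$ there is $\alpha_\beta$ with $|x_\alpha-x|\le y_\beta$ for all $\alpha\ge\alpha_\beta$. A lattice-normed space (LNS) is a triple $(X,p,E)$ with $X$ a real vector space, $E$ a vector lattice and $p:X\to E_+$ such that $p(x)=0\Leftrightarrow x=0$, $p(\lambda x)=|\lambda|p(x)$, $p(x+y)\le p(x)+p(y)$. A net $x_\alpha$ $p$-converges to $x$ (written $x_\alpha\xrightarrow{p}x$) if $p(x_\alpha-x)\xrightarrow{o}0$ in $E$. A sequence $x_n$ in $X$ is $p$-bounded if there is $e\in E$ with $p(x_n)\le e$ for all $n$. A linear operator $T:(X,p,E)\to(Y,m,F)$ is sequentially $p$-compact if for every $p$-bounded sequence $x_n$ in $X$ there are a subsequence $x_{n_k}$ and $y\in Y$ with $Tx_{n_k}\xrightarrow{p}y$. If $(E,\|\cdot\|_E)$ is a normed lattice, the mixed norm on $X$ is $p\text{-}\|x\|_E=\|p(x)\|_E$;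 similarly $m\text{-}\|y\|_F=\|m(y)\|_F$. A linear operator between normed spaces is compact if it maps the closed unit ball to a relatively compact set; equivalently, the image of every norm bounded sequence has a convergent subsequence. *)

theory Defs
  imports "HOL-Analysis.Analysis" "HOL-Library.Lattice_Algebras"
begin

class archimedean_vector_lattice = lattice_ab_group_add_abs + ordered_real_vector +
  assumes archimedean: "0 \<le> x \<Longrightarrow> (\<And>n::nat. real n *\<^sub>R x \<le> y) \<Longrightarrow> x = 0"

class normed_lattice = archimedean_vector_lattice + real_normed_vector +
  assumes norm_abs_mono: "\<bar>x\<bar> \<le> \<bar>y\<bar> \<Longrightarrow> norm x \<le> norm y"

class banach_lattice = normed_lattice + banach

text \<open>A net is a function together with a directed index set given by a carrier and a preorder.\<close>

definition directed_index :: "'i set \<Rightarrow> ('i \<Rightarrow> 'i \<Rightarrow> bool) \<Rightarrow> bool" where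
  "directed_index A le \<longleftrightarrow> A \<noteq> {} \<and> reflp_on A le \<and> transp_on A le \<and>
     (\<forall>a\<in>A. \<forall>b\<in>A. \<exists>c\<in>A. le a c \<and> le b c)"

definition net_decreases_to ::
  "'i set \<Rightarrow> ('i \<Rightarrow> 'i \<Rightarrow> bool) \<Rightarrow> ('i \<Rightarrow> 'e::order) \<Rightarrow> 'e \<Rightarrow> bool" where
  "net_decreases_to B le y l \<longleftrightarrow>
     (\<forall>a\<in>B. \<forall>b\<in>B. le a b \<longrightarrow> y b \<le> y a) \<and>
     (\<forall>b\<in>B. l \<le> y b) \<and> (\<forall>z. (\<forall>b\<in>B. z \<le> y b) \<longrightarrow> z \<le> l)"

text \<open>
  HOL cannot quantify over the type of the index set of the dominating net, so that set is taken
  inside the lattice itself. This is no restriction: by \<open>order_convergesI\<close> below, a dominating net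
  over an index set of any type will do.
\<close>

definition order_converges ::
  "'i set \<Rightarrow> ('i \<Rightarrow> 'i \<Rightarrow> bool) \<Rightarrow> ('i \<Rightarrow> 'e::archimedean_vector_lattice) \<Rightarrow> 'e \<Rightarrow> bool" where
  "order_converges A leA x l \<longleftrightarrow> directed_index A leA \<and>
     (\<exists>(B :: 'e set) leB (y :: 'e \<Rightarrow> 'e).
        directed_index B leB \<and> net_decreases_to B leB y 0 \<and>
        (\<forall>\<beta>\<in>B. \<exists>\<alpha>0\<in>A. \<forall>\<alpha>\<in>A. leA \<alpha>0 \<alpha> \<longrightarrow> \<bar>x \<alpha> - l\<bar> \<le> y \<beta>))"

lemma order_convergesI:
  fixes B :: "'b set" and y :: "'b \<Rightarrow> 'e::archimedean_vector_lattice"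
  assumes A: "directed_index A leA" and B: "directed_index B leB"
    and y: "net_decreases_to B leB y 0"
    and dom: "\<forall>\<beta>\<in>B. \<exists>\<alpha>0\<in>A. \<forall>\<alpha>\<in>A. leA \<alpha>0 \<alpha> \<longrightarrow> \<bar>x \<alpha> - l\<bar> \<le> y \<beta>"
  shows "order_converges A leA x l"
proof -
  have "directed_index (y ` B) (\<lambda>u v. v \<le> u)"
    unfolding directed_index_def
  proof (intro conjI)
    show "y ` B \<noteq> {}" using B by (auto simp: directed_index_def)
    show "reflp_on (y ` B) (\<lambda>u v. v \<le> u)" by (auto intro: reflp_onI)
    show "transp_on (y ` B) (\<lambda>u v. v \<le> u)" by (auto intro: transp_onI)
    show "\<forall>a\<in>y ` B. \<forall>b\<in>y ` B. \<exists>c\<in>y ` B. c \<le> a \<and> c \<le> b"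
      using B y unfolding directed_index_def net_decreases_to_def by blast
  qed
  moreover have "net_decreases_to (y ` B) (\<lambda>u v. v \<le> u) (\<lambda>u. u) 0"
    using y unfolding net_decreases_to_def by blast
  ultimately show ?thesis
    using A dom unfolding order_converges_def by blast
qed

definition lattice_normed_space ::
  "('x::real_vector \<Rightarrow> 'e::archimedean_vector_lattice) \<Rightarrow> bool" where
  "lattice_normed_space p \<longleftrightarrow>
     (\<forall>x. 0 \<le> p x) \<and> (\<forall>x. p x = 0 \<longleftrightarrow> x = 0) \<and>
     (\<forall>c x. p (c *\<^sub>R x) = \<bar>c\<bar> *\<^sub>R p x) \<and>
     (\<forall>x y. p (x + y) \<le> p x + p y)"

definition p_converges ::
  "('x::real_vector \<Rightarrow> 'e::archimedean_vector_lattice) \<Rightarrow>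
     'i set \<Rightarrow> ('i \<Rightarrow> 'i \<Rightarrow> bool) \<Rightarrow> ('i \<Rightarrow> 'x) \<Rightarrow> 'x \<Rightarrow> bool" where
  "p_converges p A le x l \<longleftrightarrow> order_converges A le (\<lambda>\<alpha>. p (x \<alpha> - l)) 0"

definition p_bounded_seq ::
  "('x::real_vector \<Rightarrow> 'e::archimedean_vector_lattice) \<Rightarrow> (nat \<Rightarrow> 'x) \<Rightarrow> bool" where
  "p_bounded_seq p x \<longleftrightarrow> (\<exists>e. \<forall>n. p (x n) \<le> e)"

definition sequentially_p_compact ::
  "('x::real_vector \<Rightarrow> 'e::archimedean_vector_lattice) \<Rightarrow>
     ('y::real_vector \<Rightarrow> 'f::archimedean_vector_lattice) \<Rightarrow> ('x \<Rightarrow> 'y) \<Rightarrow> bool" where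
  "sequentially_p_compact p m T \<longleftrightarrow>
     (\<forall>x. p_bounded_seq p x \<longrightarrow>
        (\<exists>r y. strict_mono r \<and> p_converges m (UNIV :: nat set) (\<le>) (\<lambda>k. T (x (r k))) y))"

definition mixed_norm :: "('x::real_vector \<Rightarrow> 'e::normed_lattice) \<Rightarrow> 'x \<Rightarrow> real" where
  "mixed_norm p x = norm (p x)"

text \<open>
  The mixed norm is not the norm of a type class instance, so norms are passed as functions;
  the topology is that of the metric they induce.
\<close>

definition norm_topology :: "('a::real_vector \<Rightarrow> real) \<Rightarrow> 'a topology" where
  "norm_topology N = Metric_space.mtopology UNIV (\<lambda>x y. N (x - y))"

definition compact_operator ::
  "('x::real_vector \<Rightarrow> real) \<Rightarrow> ('y::real_vector \<Rightarrow> real) \<Rightarrow> ('x \<Rightarrow> 'y) \<Rightarrow> bool" where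
  "compact_operator N M T \<longleftrightarrow>
     compactin (norm_topology M) (norm_topology M closure_of (T ` {x. N x \<le> 1}))"

lemma Metric_space_mixed_norm:
  assumes "lattice_normed_space p"
  shows "Metric_space UNIV (\<lambda>x y. mixed_norm p (x - y))"
proof
  have p0: "0 \<le> p x" and pz: "p x = 0 \<longleftrightarrow> x = 0" and ps: "p (c *\<^sub>R x) = \<bar>c\<bar> *\<^sub>R p x"
    and pt: "p (x + y) \<le> p x + p y" for x y c
    using assms by (auto simp: lattice_normed_space_def)
  fix x y z
  show "0 \<le> mixed_norm p (x - y)" by (simp add: mixed_norm_def)
  show "mixed_norm p (x - y) = mixed_norm p (y - x)"
    using ps[of "-1" "x - y"] by (simp add: mixed_norm_def)
  show "mixed_norm p (x - y) = 0 \<longleftrightarrow> x = y" by (simp add: mixed_norm_def pz)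
  have "p (x - z) \<le> p (x - y) + p (y - z)" using pt[of "x - y" "y - z"] by simp
  then have "\<bar>p (x - z)\<bar> \<le> \<bar>p (x - y) + p (y - z)\<bar>"
    by (simp add: abs_of_nonneg p0 add_nonneg_nonneg)
  then have "norm (p (x - z)) \<le> norm (p (x - y) + p (y - z))" by (rule norm_abs_mono)
  also have "\<dots> \<le> norm (p (x - y)) + norm (p (y - z))" by (rule norm_triangle_ineq)
  finally show "mixed_norm p (x - z) \<le> mixed_norm p (x - y) + mixed_norm p (y - z)"
    by (simp add: mixed_norm_def)
qed

end

theory Submission
  imports Defs
begin

text \<open>
  Compactness yields a subsequence converging in the mixed norm, and a further subsequence along
  which the lattice norms \<open>u k\<close> of the differences have a summable norm. In the Banach lattice the
  tails \<open>\<Sum>i. u (i + n)\<close> then exist; they dominate \<open>u k\<close> for \<open>k \<ge> n\<close> and decrease to zero.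
\<close>

text \<open>Since \<open>x n\<close> is nonnegative, the negative part \<open>sup (- l) 0\<close>
  lies below the modulus of \<open>x n - l\<close>. Monotonicity of the norm then forces this fixed
  element to have norm zero.\<close>

lemma normed_lattice_LIMSEQ_nonneg:
  fixes x :: "nat \<Rightarrow> 'a::normed_lattice"
  assumes "x \<longlonglongrightarrow> l" and "\<And>n. 0 \<le> x n"
  shows "0 \<le> l"
proof -
  have "norm (sup (- l) 0) \<le> norm (x n - l)" for n
  proof (rule norm_abs_mono)
    have "- l \<le> x n - l" using assms(2)[of n] by simp
    also have "\<dots> \<le> \<bar>x n - l\<bar>" by (rule abs_ge_self)
    finally have "sup (- l) 0 \<le> \<bar>x n - l\<bar>" by simp
    then show "\<bar>sup (- l) 0\<bar> \<le> \<bar>x n - l\<bar>" by simp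
  qed
  moreover have "(\<lambda>n. norm (x n - l)) \<longlonglongrightarrow> 0"
    using assms(1) by (simp add: tendsto_norm_zero LIM_zero)
  ultimately have "norm (sup (- l) 0) \<le> 0"
    by (intro LIMSEQ_le_const) auto
  then have "sup (- l) 0 = 0" by simp
  then have "- l \<le> 0" by (metis sup_ge1)
  then show ?thesis by simp
qed

lemma normed_lattice_suminf_nonneg:
  fixes u :: "nat \<Rightarrow> 'a::normed_lattice"
  assumes "summable u" and "\<And>n. 0 \<le> u n"
  shows "0 \<le> suminf u"
  using summable_LIMSEQ[OF assms(1)]
  by (rule normed_lattice_LIMSEQ_nonneg) (simp add: assms(2) sum_nonneg)

lemma order_converges_zero_if_summable_norm:
  fixes u :: "nat \<Rightarrow> 'a::banach_lattice"
  assumes nonneg: "\<And>n. 0 \<le> u n" and sn: "summable (\<lambda>n. norm (u n))"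
  shows "order_converges (UNIV :: nat set) (\<le>) u 0"
proof -
  define y where "y n = (\<Sum>i. u (i + n))" for n
  \<comment> \<open>Completeness of the lattice enters here: an absolutely convergent series
    converges.\<close>
  have summ: "summable u" using sn by (rule summable_norm_cancel)
  have summ_tail: "summable (\<lambda>i. u (i + n))" for n
    using summ by (rule summable_ignore_initial_segment)
  have y0: "0 \<le> y n" for n
    unfolding y_def using summ_tail by (rule normed_lattice_suminf_nonneg) (rule nonneg)
  \<comment> \<open>Splitting off the first term serves twice: it makes \<open>y\<close> decreasing,
    and it gives \<open>u k \<le> y k\<close> because the remaining tail is nonnegative.\<close>
  have step: "y n = u n + y (Suc n)" for n
    using suminf_split_head[OF summ_tail[of n]] by (simp add: y_def)
  have "y (Suc n) \<le> y n" for n using nonneg[of n] by (simp add: step[of n])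
  then have anti: "antimono y" by (simp add: antimono_iff_le_Suc)
  have dom: "u k \<le> y n" if "n \<le> k" for n k
  proof -
    have "u k \<le> y k" using y0[of "Suc k"] by (simp add: step[of k])
    also have "y k \<le> y n" using anti that by (rule antimonoD)
    finally show ?thesis .
  qed
  have "y = (\<lambda>n. suminf u - sum u {..<n})"
    unfolding y_def using suminf_minus_initial_segment[OF summ] by auto
  then have lim: "y \<longlonglongrightarrow> 0"
    using tendsto_diff[OF tendsto_const summable_LIMSEQ[OF summ], of "suminf u"] by simp
  \<comment> \<open>Norm convergence becomes an infimum: for a lower bound \<open>z\<close> the
    elements \<open>y n - z\<close> are nonnegative and tend to \<open>- z\<close>, and the positive
    cone is norm closed.\<close>
  have inf: "z \<le> 0" if "\<And>n. z \<le> y n" for z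
    using normed_lattice_LIMSEQ_nonneg[OF tendsto_diff[OF lim tendsto_const[of z]]] that by simp
  have dir: "directed_index (UNIV :: nat set) (\<le>)"
    unfolding directed_index_def
  proof (intro conjI ballI)
    fix a b :: nat
    show "\<exists>c\<in>UNIV. a \<le> c \<and> b \<le> c"
      by (rule bexI[of _ "max a b"]) simp_all
  qed (simp_all add: reflp_on_def transp_on_def)
  show ?thesis
  proof (rule order_convergesI[OF dir dir])
    show "net_decreases_to UNIV (\<le>) y 0"
      unfolding net_decreases_to_def using anti y0 inf by (simp add: monotone_def)
    \<comment> \<open>By \<open>dom\<close>, the index \<open>\<beta>\<close> itself serves as the
      threshold \<open>\<alpha>0\<close>.\<close>
    show "\<forall>\<beta>\<in>UNIV. \<exists>\<alpha>0\<in>UNIV. \<forall>\<alpha>\<in>UNIV. \<alpha>0 \<le> \<alpha> \<longrightarrow> \<bar>u \<alpha> - 0\<bar> \<le> y \<beta>"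
      using dom nonneg by auto
  qed
qed

text \<open>Indices are picked one after another, each beyond the last, so that the
  \<open>n\<close>-th chosen term is at most \<open>(1/2) ^ n\<close>; the geometric series then
  dominates.\<close>

lemma subsequence_summable:
  fixes a :: "nat \<Rightarrow> real"
  assumes "a \<longlonglongrightarrow> 0" and "\<And>n. 0 \<le> a n"
  obtains r where "strict_mono r" and "summable (a \<circ> r)"
proof -
  obtain r :: "nat \<Rightarrow> nat" where r: "strict_mono r" "\<And>n. a (r n) \<le> (1/2) ^ n"
  proof -
    have "\<exists>r::nat\<Rightarrow>nat. \<forall>n. a (r n) \<le> (1/2) ^ n \<and> r n < r (Suc n)"
    proof (rule dependent_nat_choice)
      have ev: "\<forall>\<^sub>F k in sequentially. a k < (1/2) ^ n" for n
        using assms(1) by (rule order_tendstoD) simp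
      show "\<exists>k. a k \<le> (1/2) ^ 0"
        using eventually_happens[OF ev[of 0]] by (auto intro: less_imp_le)
      show "\<exists>k'. a k' \<le> (1/2) ^ Suc n \<and> k < k'" for k n
        using eventually_happens[OF eventually_conj[OF ev[of "Suc n"] eventually_gt_at_top[of k]]]
        by (auto intro: less_imp_le)
    qed
    then show ?thesis using that by (auto simp: strict_mono_Suc_iff)
  qed
  have "summable (a \<circ> r)"
    by (rule summable_comparison_test'[of "\<lambda>n. (1/2::real) ^ n"])
       (simp_all add: r(2) assms(2) summable_geometric)
  with r(1) show ?thesis by (rule that)
qed

text \<open>Compactness speaks only of the unit ball, so the sequence is scaled into it, a
  convergent subsequence of the images is extracted, and linearity undoes the scaling.\<close>

lemma compact_operator_subsequence:
  fixes p :: "'x::real_vector \<Rightarrow> 'e::normed_lattice"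
    and m :: "'y::real_vector \<Rightarrow> 'f::normed_lattice"
    and x :: "nat \<Rightarrow> 'x"
  assumes p: "lattice_normed_space p" and m: "lattice_normed_space m"
    and T: "linear T" and comp: "compact_operator (mixed_norm p) (mixed_norm m) T"
    and bdd: "\<And>n. mixed_norm p (x n) \<le> K"
  obtains r y where "strict_mono r" "(\<lambda>k. mixed_norm m (T (x (r k)) - y)) \<longlonglongrightarrow> 0"
proof -
  interpret M: Metric_space UNIV "\<lambda>x y. mixed_norm m (x - y)"
    using m by (rule Metric_space_mixed_norm)
  \<comment> \<open>The maximum with 1 keeps the divisor positive even when \<open>K\<close> is
    0.\<close>
  define C where "C = max K 1"
  have C: "C > 0" "K \<le> C" by (auto simp: C_def)
  have hom_p: "mixed_norm p (c *\<^sub>R v) = \<bar>c\<bar> * mixed_norm p v" for c v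
    using p by (simp add: lattice_normed_space_def mixed_norm_def)
  have hom_m: "mixed_norm m (c *\<^sub>R v) = \<bar>c\<bar> * mixed_norm m v" for c v
    using m by (simp add: lattice_normed_space_def mixed_norm_def)
  define w where "w n = T ((1/C) *\<^sub>R x n)" for n
  define S where "S = M.mtopology closure_of (T ` {x. mixed_norm p x \<le> 1})"
  have "mixed_norm p ((1/C) *\<^sub>R x n) \<le> 1" for n
    using bdd[of n] C by (simp add: hom_p)
  then have "range w \<subseteq> T ` {x. mixed_norm p x \<le> 1}" by (auto simp: w_def)
  also have "\<dots> \<subseteq> S" unfolding S_def by (rule closure_of_subset) simp
  finally have "range w \<subseteq> S" .
  moreover have "compactin M.mtopology S"
    using comp by (simp add: compact_operator_def norm_topology_def S_def)
  \<comment> \<open>In a metric space a compact set is sequentially compact.\<close>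
  ultimately obtain z r where r: "strict_mono r"
    and lim: "limitin M.mtopology (w \<circ> r) z sequentially"
    unfolding M.compactin_sequentially by blast
  have lim0: "(\<lambda>k. mixed_norm m (w (r k) - z)) \<longlonglongrightarrow> 0"
    using lim by (simp add: M.limitin_metric_dist_null o_def)
  \<comment> \<open>The limit \<open>z\<close> of the scaled images corresponds to the limit
    \<open>C *\<^sub>R z\<close> of the original ones.\<close>
  have "T (x n) - C *\<^sub>R z = C *\<^sub>R (w n - z)" for n
    using C by (simp add: w_def linear_scale[OF T] scaleR_diff_right)
  then have "mixed_norm m (T (x n) - C *\<^sub>R z) = C * mixed_norm m (w n - z)" for n
    using C by (simp add: hom_m)
  then have "(\<lambda>k. mixed_norm m (T (x (r k)) - C *\<^sub>R z)) \<longlonglongrightarrow> 0"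
    using tendsto_mult_left[OF lim0, of C] by simp
  with r show ?thesis by (rule that)
qed

theorem proposition7:
  fixes p :: "'x::real_vector \<Rightarrow> 'e::normed_lattice"
    and m :: "'y::real_vector \<Rightarrow> 'f::banach_lattice"
    and T :: "'x \<Rightarrow> 'y"
  assumes "lattice_normed_space p"
    and "lattice_normed_space m"
    and "linear T"
    and "compact_operator (mixed_norm p) (mixed_norm m) T"
  shows "sequentially_p_compact p m T"
  unfolding sequentially_p_compact_def
proof (intro allI impI)
  fix x assume "p_bounded_seq p x"
  then obtain e where e: "\<And>n. p (x n) \<le> e" by (auto simp: p_bounded_seq_def)
  have p0: "0 \<le> p v" for v using assms(1) by (simp add: lattice_normed_space_def)
  have m0: "0 \<le> m v" for v using assms(2) by (simp add: lattice_normed_space_def)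
  \<comment> \<open>Monotonicity of the norm turns the order bound \<open>e\<close> into the norm
    bound \<open>norm e\<close>.\<close>
  have "\<bar>p (x n)\<bar> \<le> \<bar>e\<bar>" for n
    using order_trans[OF e abs_ge_self] by (simp add: p0)
  then have "mixed_norm p (x n) \<le> norm e" for n
    by (simp add: mixed_norm_def norm_abs_mono)
  then obtain r y where r: "strict_mono r"
    and lim: "(\<lambda>k. mixed_norm m (T (x (r k)) - y)) \<longlonglongrightarrow> 0"
    by (rule compact_operator_subsequence[OF assms])
  obtain s where s: "strict_mono s"
    and summ: "summable ((\<lambda>k. mixed_norm m (T (x (r k)) - y)) \<circ> s)"
    using lim by (rule subsequence_summable) (simp add: mixed_norm_def)
  \<comment> \<open>Here \<open>u k\<close> is \<open>m (T (x (r (s k))) - y)\<close>, whose norm is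
    by definition the mixed norm made summable by \<open>s\<close>.\<close>
  have "p_converges m (UNIV :: nat set) (\<le>) (\<lambda>k. T (x ((r \<circ> s) k))) y"
    unfolding p_converges_def using summ
    by (intro order_converges_zero_if_summable_norm) (simp_all add: m0 mixed_norm_def o_def)
  moreover have "strict_mono (r \<circ> s)" using r s by (rule strict_mono_o)
  ultimately show "\<exists>r y. strict_mono r \<and>
      p_converges m (UNIV :: nat set) (\<le>) (\<lambda>k. T (x (r k))) y"
    by blast
qed

end
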